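(* Let $N\ge 2$ be an integer and let $R_N$ be the equivalence relation on $[0,1]$ (with Lebesgue measure $\lambda$) given by $(x,y)\in R_N$ iff there exists $f\in F(N)$ with $f(x)=y$. Then $R_N$ is a standard, quasi-preserving, ergodic equivalence relation.
   Context: For an integer $N\ge 2$, an $N$-adic rational is a number $k/N^m$ with $k,m\in\mathbb{Z}$. The generalized Thompson group $F(N)$ is the group (under composition) of piecewise linear homeomorphisms $f:[0,1]\to[0,1]$ that are differentiable except at finitely many points, all of which are $N$-adic rationals, and whose derivatives on intervals of differentiability are (integer) powers of $N$. Let $R$ be an equivalence relation on a standard probability space $(X,\lambda)$. - $R$ is standard if almost every orbit $R[x]=\{y:(x,y)\in R\}$ is at most countable and $R$ is a Borel subset of $X\times X$. - $R$ is quasi-preserving if the saturation $\{y : \exists x\in A,\ (x,y)\in R\}$ of every null set $A$ is null. - $R$ is ergodic if every $R$-saturated Borel set (i.e. a Borel set that is a union of $R$-classes) has measure $0$ or $1$. *)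

theory Defs
  imports "HOL-Analysis.Analysis"
begin

definition nadic_rationals :: "nat \<Rightarrow> real set" where
  "nadic_rationals N = {of_int k / real N powi m | k m :: int. True}"

text \<open>No continuity is built in, and the values at the finitely many breakpoints are unconstrained;
  continuity across them comes from the homeomorphism condition below.\<close>

definition piecewise_linear_on :: "real \<Rightarrow> real \<Rightarrow> (real \<Rightarrow> real) \<Rightarrow> bool" where
  "piecewise_linear_on a b f \<longleftrightarrow>
     (\<exists>S. finite S \<and>
        (\<forall>u v. a \<le> u \<and> u < v \<and> v \<le> b \<and> {u<..<v} \<inter> S = {} \<longrightarrow>
           (\<exists>m c. \<forall>x\<in>{u<..<v}. f x = m * x + c)))"

text \<open>Underlying set of the group. A map from the unit interval to itself is represented by a
  function on the reals that is \<open>undefined\<close> outside the interval, so that equality of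
  representatives is equality of maps. Derivatives at the endpoints are one-sided.\<close>

definition thompson_F :: "nat \<Rightarrow> (real \<Rightarrow> real) set" where
  "thompson_F N = {f \<in> extensional {0..1}.
     (\<exists>g. homeomorphism {0..1} {0..1} f g) \<and>
     piecewise_linear_on 0 1 f \<and>
     finite {x \<in> {0..1}. \<not> f differentiable (at x within {0..1})} \<and>
     {x \<in> {0..1}. \<not> f differentiable (at x within {0..1})} \<subseteq> nadic_rationals N \<and>
     (\<forall>x\<in>{0..1}. f differentiable (at x within {0..1}) \<longrightarrow>
        (\<exists>k::int. (f has_real_derivative (real N powi k)) (at x within {0..1})))}"

definition thompson_orbit_rel :: "nat \<Rightarrow> (real \<times> real) set" where
  "thompson_orbit_rel N =
     {(x, y). x \<in> {0..1} \<and> y \<in> {0..1} \<and> (\<exists>f\<in>thompson_F N. f x = y)}"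

text \<open>In the following notions \<open>M\<close> is a Borel probability measure, i.e. its measurable sets
  are the Borel sets of the underlying standard Borel space.\<close>

definition standard_rel :: "'a measure \<Rightarrow> ('a \<times> 'a) set \<Rightarrow> bool" where
  "standard_rel M R \<longleftrightarrow> (AE x in M. countable (R `` {x})) \<and> R \<in> sets (M \<Otimes>\<^sub>M M)"

text \<open>Null sets are arbitrary (not necessarily Borel) sets of measure zero, hence the completion.\<close>

definition quasi_preserving_rel :: "'a measure \<Rightarrow> ('a \<times> 'a) set \<Rightarrow> bool" where
  "quasi_preserving_rel M R \<longleftrightarrow>
     (\<forall>A \<in> null_sets (completion M). R `` A \<in> null_sets (completion M))"

definition ergodic_rel :: "'a measure \<Rightarrow> ('a \<times> 'a) set \<Rightarrow> bool" where
  "ergodic_rel M R \<longleftrightarrow>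
     (\<forall>A \<in> sets M. (\<exists>C \<subseteq> space M // R. A = \<Union>C) \<longrightarrow> emeasure M A = 0 \<or> emeasure M A = 1)"

text \<open>Lebesgue measure on the Borel subsets of the unit interval.\<close>

definition unit_lebesgue :: "real measure" where
  "unit_lebesgue = restrict_space lborel {0..1}"

end

theory Submission
  imports Defs "HOL-Probability.Distribution_Functions"
begin

text \<open>
  On an interval without breakpoints an element of \<open>F(N)\<close> is differentiable with derivative in a
  countable set, so its difference quotients, which form a connected subset of that set, are
  constant. Starting at \<open>0\<close> one sees inductively that breakpoints are mapped to \<open>N\<close>-adic
  rationals. Hence an element is determined by its graph over the breakpoints, and \<open>F(N)\<close> is a
  countable group: the orbit relation is a countable union of compact graphs, and each element,
  being differentiable off a finite set, preserves null sets.

  For ergodicity, \<open>x \<mapsto> min (N x, x + (N - 1) p, 1 - (1 - x) / N)\<close> belongs to \<open>F(N)\<close> for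
  \<open>N\<close>-adic \<open>p\<close> and translates \<open>[p, 1 - N p]\<close> by \<open>(N - 1) p\<close>. Iterating it with small \<open>p\<close>,
  one finds that a saturated set \<open>A\<close> is invariant under a dense set of translations within
  \<open>(0, 1)\<close>. If \<open>A\<close> has positive measure, the conditional distribution of Lebesgue measure on \<open>A\<close>
  therefore has an additive, continuous distribution function on \<open>[0, 1]\<close>, so it is the uniform
  distribution; evaluating both at \<open>A\<close> gives \<open>\<lambda>(A) = 1\<close>.
\<close>

section \<open>\<open>N\<close>-adic rationals and \<open>N\<close>-adic affine maps\<close>

lemma nadic_rationals_eq_div_power:
  assumes "N > 0"
  shows "nadic_rationals N = {of_int k / real N ^ n | k n. True}"
proof (intro equalityI subsetI)
  fix x assume "x \<in> nadic_rationals N"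
  then obtain k m :: int where x_eq: "x = of_int k / real N powi m"
    by (auto simp: nadic_rationals_def)
  show "x \<in> {of_int k / real N ^ n | k n. True}"
  proof (cases "m \<ge> 0")
    case True
    then show ?thesis using x_eq by (auto simp: power_int_def)
  next
    case False
    then have "x = of_int (k * int N ^ nat (- m)) / real N ^ 0"
      using x_eq assms by (simp add: power_int_def field_simps)
    then show ?thesis by blast
  qed
next
  fix x assume "x \<in> {of_int k / real N ^ n | k n. True}"
  then obtain k :: int and n :: nat where "x = of_int k / real N powi (int n)"
    by auto
  then show "x \<in> nadic_rationals N"
    unfolding nadic_rationals_def by blast
qed

lemma nadic_rationals_of_int: "of_int k \<in> nadic_rationals N"
  unfolding nadic_rationals_def by (intro CollectI exI[of _ k] exI[of _ 0]) simp

lemma nadic_rationals_0_1 [simp]: "0 \<in> nadic_rationals N" "1 \<in> nadic_rationals N"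
  using nadic_rationals_of_int[of 0 N] nadic_rationals_of_int[of 1 N] by simp_all

lemma nadic_rationals_add:
  assumes N_pos: "N > 0"
    and x_nadic: "x \<in> nadic_rationals N" and y_nadic: "y \<in> nadic_rationals N"
  shows "x + y \<in> nadic_rationals N"
proof -
  obtain k l :: int and m n :: nat
    where xy_eq: "x = of_int k / real N ^ m" "y = of_int l / real N ^ n"
    using x_nadic y_nadic unfolding nadic_rationals_eq_div_power[OF N_pos] by auto
  have "x + y = of_int (k * int N ^ n + l * int N ^ m) / real N ^ (m + n)"
    unfolding xy_eq using N_pos by (simp add: field_simps power_add)
  then show ?thesis
    unfolding nadic_rationals_eq_div_power[OF N_pos] by blast
qed

lemma nadic_rationals_mult_powi:
  assumes N_pos: "N > 0" and x_nadic: "x \<in> nadic_rationals N"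
  shows "real N powi k * x \<in> nadic_rationals N"
proof -
  obtain l m :: int where "x = of_int l / real N powi m"
    using x_nadic unfolding nadic_rationals_def by auto
  then have "real N powi k * x = of_int l / real N powi (m - k)"
    using N_pos by (simp add: power_int_diff)
  then show ?thesis
    unfolding nadic_rationals_def by blast
qed

lemma nadic_rationals_uminus:
  assumes "x \<in> nadic_rationals N"
  shows "- x \<in> nadic_rationals N"
proof -
  obtain k m :: int where "x = of_int k / real N powi m"
    using assms unfolding nadic_rationals_def by auto
  then have "- x = of_int (- k) / real N powi m"
    by simp
  then show ?thesis
    unfolding nadic_rationals_def by blast
qed

lemma nadic_rationals_diff:
  "N > 0 \<Longrightarrow> x \<in> nadic_rationals N \<Longrightarrow> y \<in> nadic_rationals N \<Longrightarrow> x - y \<in> nadic_rationals N"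
  using nadic_rationals_add[of N x "- y"] nadic_rationals_uminus[of y N] by simp

lemma countable_nadic_rationals: "countable (nadic_rationals N)"
proof -
  have "nadic_rationals N = (\<lambda>(k, m). of_int k / real N powi m) ` (UNIV :: (int \<times> int) set)"
    by (auto simp: nadic_rationals_def)
  then show ?thesis
    by simp
qed

lemma closure_nadic_rationals:
  assumes "N \<ge> 2"
  shows "closure (nadic_rationals N) = UNIV"
proof -
  have "\<exists>y\<in>nadic_rationals N. dist y x < e" if e_pos: "e > 0" for x e :: real
  proof -
    obtain n q r where "of_int q / real N ^ n < x" "x < of_int r / real N ^ n"
      and "\<bar>of_int q / real N ^ n - of_int r / real N ^ n\<bar> < e"
      by (rule padic_rational_approximation_straddle[of e "real N" x]) (use e_pos assms in auto)
    then have "dist (of_int q / real N ^ n) x < e"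
      by (simp add: dist_real_def)
    then show ?thesis
      using assms by (intro bexI) (auto simp: nadic_rationals_eq_div_power)
  qed
  then show ?thesis
    by (auto simp: closure_approachable)
qed

definition nadic_affine :: "nat \<Rightarrow> (real \<Rightarrow> real) set" where
  "nadic_affine N = {\<lambda>x. real N powi k * x + c | k c. c \<in> nadic_rationals N}"

lemma nadic_affineI:
  "c \<in> nadic_rationals N \<Longrightarrow> (\<lambda>x. real N powi k * x + c) \<in> nadic_affine N"
  by (auto simp: nadic_affine_def)

lemma nadic_affine_bexI:
  assumes "c \<in> nadic_rationals N" "\<And>x. x \<in> X \<Longrightarrow> f x = real N powi k * x + c"
  shows "\<exists>h\<in>nadic_affine N. \<forall>x\<in>X. f x = h x"
  using nadic_affineI[OF assms(1)] assms(2) by (intro bexI[of _ "\<lambda>x. real N powi k * x + c"]) auto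

lemma nadic_affineE:
  assumes "h \<in> nadic_affine N"
  obtains k c where "c \<in> nadic_rationals N" "h = (\<lambda>x. real N powi k * x + c)"
  using assms by (auto simp: nadic_affine_def)

lemma nadic_affine_comp:
  assumes N_pos: "N > 0" and "g \<in> nadic_affine N" "h \<in> nadic_affine N"
  shows "g \<circ> h \<in> nadic_affine N"
proof -
  obtain k c l d where g_eq: "c \<in> nadic_rationals N" "g = (\<lambda>x. real N powi k * x + c)"
    and h_eq: "d \<in> nadic_rationals N" "h = (\<lambda>x. real N powi l * x + d)"
    using assms(2,3) by (elim nadic_affineE)
  have "g \<circ> h = (\<lambda>x. real N powi (k + l) * x + (real N powi k * d + c))"
    using N_pos by (simp add: g_eq h_eq fun_eq_iff power_int_add algebra_simps)
  then show ?thesis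
    using N_pos g_eq h_eq
    by (simp only:) (intro nadic_affineI nadic_rationals_add nadic_rationals_mult_powi)
qed

lemma nadic_affine_inverse:
  assumes N_pos: "N > 0" and "h \<in> nadic_affine N"
  obtains g where "g \<in> nadic_affine N" "\<And>x. g (h x) = x" "\<And>y. h (g y) = y"
proof -
  obtain k c where h_eq: "c \<in> nadic_rationals N" "h = (\<lambda>x. real N powi k * x + c)"
    using assms(2) by (elim nadic_affineE)
  show thesis
  proof
    show "(\<lambda>y. real N powi (- k) * y + - (real N powi (- k) * c)) \<in> nadic_affine N"
      using N_pos h_eq(1) by (intro nadic_affineI nadic_rationals_uminus nadic_rationals_mult_powi)
  qed (use N_pos in \<open>simp_all add: h_eq(2) power_int_minus field_simps\<close>)
qed

lemma strict_mono_nadic_affine: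
  assumes "N > 0" "h \<in> nadic_affine N"
  shows "strict_mono h"
  using assms(2) by (rule nadic_affineE) (use assms(1) in \<open>simp add: strict_mono_def\<close>)

lemma nadic_affine_image_Ioo:
  assumes "N > 0" "h \<in> nadic_affine N"
  shows "h ` {u<..<v} = {h u<..<h v}"
proof (intro equalityI subsetI)
  fix y assume between: "y \<in> {h u<..<h v}"
  obtain x where "h x = y"
    using nadic_affine_inverse[OF assms] by metis
  then show "y \<in> h ` {u<..<v}"
    using between strict_mono_less[OF strict_mono_nadic_affine[OF assms]] by auto
qed (use strict_mono_less[OF strict_mono_nadic_affine[OF assms]] in auto)

lemma nadic_affine_in_nadic_rationals_iff:
  assumes N_pos: "N > 0" and h_affine: "h \<in> nadic_affine N"
  shows "h x \<in> nadic_rationals N \<longleftrightarrow> x \<in> nadic_rationals N"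
proof -
  have affine_preserves: "g y \<in> nadic_rationals N"
    if "g \<in> nadic_affine N" "y \<in> nadic_rationals N" for g y
    using that(1) by (rule nadic_affineE)
      (use N_pos that(2) in \<open>simp add: nadic_rationals_add nadic_rationals_mult_powi\<close>)
  show ?thesis
    using nadic_affine_inverse[OF N_pos h_affine] affine_preserves h_affine by metis
qed

lemma nadic_affine_eqI:
  assumes "g \<in> nadic_affine N" "h \<in> nadic_affine N" and "g r = h r" "g s = h s" "r \<noteq> s"
  shows "g = h"
proof -
  obtain k c l d where g_eq: "g = (\<lambda>x. real N powi k * x + c)"
    and h_eq: "h = (\<lambda>x. real N powi l * x + d)"
    using assms(1,2) by (elim nadic_affineE)
  have "(real N powi k - real N powi l) * (r - s) = 0"
    using assms(3,4) by (simp add: g_eq h_eq algebra_simps)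
  then show ?thesis
    using assms(3,5) by (simp add: g_eq h_eq)
qed

lemma has_real_derivative_nadic_affine:
  assumes "h \<in> nadic_affine N"
  obtains k where "\<And>x S. (h has_real_derivative real N powi k) (at x within S)"
proof -
  obtain k c where h_eq: "h = (\<lambda>x. real N powi k * x + c)"
    using assms by (elim nadic_affineE)
  have "(h has_real_derivative real N powi k) (at x within S)" for x S
    unfolding h_eq by (auto intro!: derivative_eq_intros)
  then show thesis
    by (rule that)
qed

section \<open>Elements of the Thompson group as piecewise \<open>N\<close>-adic affine maps\<close>

lemma finite_consecutive_around:
  fixes S :: "'a::linorder set"
  assumes "finite S" "a \<in> S" "b \<in> S" "a < b" "x \<in> {a..b}"
  obtains r s where "r \<in> S" "s \<in> S" "a \<le> r" "r < s" "s \<le> b" "x \<in> {r..s}" "{r<..<s} \<inter> S = {}"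
proof
  let ?L = "{t \<in> S. t < b \<and> t \<le> x}"
  let ?R = "{t \<in> S. Max ?L < t}"
  have L_finite: "finite ?L" "?L \<noteq> {}"
    using assms by auto
  then have Max_L: "Max ?L \<in> ?L"
    by (rule Max_in)
  then have "b \<in> ?R"
    using assms by auto
  then have R_finite: "finite ?R" "?R \<noteq> {}"
    using assms by auto
  then have Min_R: "Min ?R \<in> ?R"
    by (rule Min_in)
  show "Max ?L \<in> S" "Min ?R \<in> S" "Max ?L < Min ?R"
    using Max_L Min_R by auto
  show "a \<le> Max ?L"
    using L_finite(1) assms by (intro Max_ge) auto
  show "Min ?R \<le> b"
    using R_finite(1) \<open>b \<in> ?R\<close> by (rule Min_le)
  have "x \<le> Min ?R"
  proof (rule ccontr)
    assume "\<not> x \<le> Min ?R"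
    then have "Min ?R \<in> ?L"
      using Min_R assms(5) by auto
    then show False
      using Max_ge[OF L_finite(1)] Min_R by force
  qed
  then show "x \<in> {Max ?L..Min ?R}"
    using Max_L by auto
  show "{Max ?L<..<Min ?R} \<inter> S = {}"
    using Min_le[OF R_finite(1)] by force
qed

definition nadic_piecewise :: "nat \<Rightarrow> real set \<Rightarrow> (real \<Rightarrow> real) \<Rightarrow> bool" where
  "nadic_piecewise N S f \<longleftrightarrow> finite S \<and> {0, 1} \<subseteq> S \<and> S \<subseteq> nadic_rationals N \<inter> {0..1} \<and>
     (\<forall>u v. 0 \<le> u \<and> u < v \<and> v \<le> 1 \<and> {u<..<v} \<inter> S = {} \<longrightarrow>
        (\<exists>h\<in>nadic_affine N. \<forall>x\<in>{u..v}. f x = h x))"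

lemma nadic_piecewiseI:
  assumes "finite S" "{0, 1} \<subseteq> S" "S \<subseteq> nadic_rationals N" "S \<subseteq> {0..1}"
    and "\<And>u v. 0 \<le> u \<Longrightarrow> u < v \<Longrightarrow> v \<le> 1 \<Longrightarrow> {u<..<v} \<inter> S = {} \<Longrightarrow>
      \<exists>h\<in>nadic_affine N. \<forall>x\<in>{u..v}. f x = h x"
  shows "nadic_piecewise N S f"
  using assms unfolding nadic_piecewise_def by blast

lemma nadic_piecewiseD:
  assumes "nadic_piecewise N S f"
  shows "finite S" "{0, 1} \<subseteq> S" "S \<subseteq> nadic_rationals N" "S \<subseteq> {0..1}"
  using assms unfolding nadic_piecewise_def by blast+

lemma nadic_piecewise_gapE:
  assumes "nadic_piecewise N S f" "0 \<le> u" "u < v" "v \<le> 1" "{u<..<v} \<inter> S = {}"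
  obtains h where "h \<in> nadic_affine N" "\<And>x. x \<in> {u..v} \<Longrightarrow> f x = h x"
  using assms unfolding nadic_piecewise_def by metis

lemma nadic_piecewise_pieceE:
  assumes f_pw: "nadic_piecewise N S f" and x_unit: "x \<in> {0..1}"
  obtains r s h where "r \<in> S" "s \<in> S" "r < s" "x \<in> {r..s}" "{r<..<s} \<inter> S = {}"
    "h \<in> nadic_affine N" "\<And>z. z \<in> {r..s} \<Longrightarrow> f z = h z"
proof -
  obtain r s where consecutive: "r \<in> S" "s \<in> S" "0 \<le> r" "r < s" "s \<le> 1"
    "x \<in> {r..s}" "{r<..<s} \<inter> S = {}"
    by (rule finite_consecutive_around[of S 0 1 x]) (use nadic_piecewiseD[OF f_pw] x_unit in auto)
  obtain h where "h \<in> nadic_affine N" "\<And>z. z \<in> {r..s} \<Longrightarrow> f z = h z"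
    using nadic_piecewise_gapE[OF f_pw consecutive(3-5,7)] by metis
  with consecutive(1,2,4,6,7) show thesis by (rule that)
qed

lemma nadic_piecewise_transform:
  assumes f_pw: "nadic_piecewise N S f" and g_eq_f: "\<And>x. x \<in> {0..1} \<Longrightarrow> g x = f x"
  shows "nadic_piecewise N S g"
proof (rule nadic_piecewiseI)
  fix u v :: real assume gap: "0 \<le> u" "u < v" "v \<le> 1" "{u<..<v} \<inter> S = {}"
  then obtain h where "h \<in> nadic_affine N" "\<And>x. x \<in> {u..v} \<Longrightarrow> f x = h x"
    using nadic_piecewise_gapE[OF f_pw] by metis
  then show "\<exists>h\<in>nadic_affine N. \<forall>x\<in>{u..v}. g x = h x"
    using g_eq_f gap by force
qed (use nadic_piecewiseD[OF f_pw] in auto)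

lemma nadic_piecewise_in_nadic_rationals_iff:
  assumes "N > 0" "nadic_piecewise N S f" "x \<in> {0..1}"
  shows "f x \<in> nadic_rationals N \<longleftrightarrow> x \<in> nadic_rationals N"
  using assms by (metis nadic_piecewise_pieceE nadic_affine_in_nadic_rationals_iff)

lemma nadic_piecewise_eqI:
  assumes f_pw: "nadic_piecewise N S f" and g_pw: "nadic_piecewise N S g"
    and eq_on_S: "\<And>s. s \<in> S \<Longrightarrow> f s = g s" and x_unit: "x \<in> {0..1}"
  shows "f x = g x"
proof -
  obtain r s h where consecutive: "r \<in> S" "s \<in> S" "r < s" "x \<in> {r..s}" "{r<..<s} \<inter> S = {}"
    and f_eq_h: "h \<in> nadic_affine N" "\<And>z. z \<in> {r..s} \<Longrightarrow> f z = h z"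
    using nadic_piecewise_pieceE[OF f_pw x_unit] by metis
  have "0 \<le> r" "s \<le> 1"
    using consecutive nadic_piecewiseD(4)[OF f_pw] by auto
  then obtain h' where g_eq_h': "h' \<in> nadic_affine N" "\<And>z. z \<in> {r..s} \<Longrightarrow> g z = h' z"
    using nadic_piecewise_gapE[OF g_pw] consecutive by metis
  have "h = h'"
    using f_eq_h g_eq_h' eq_on_S consecutive by (intro nadic_affine_eqI[of h N h' r s]) force+
  then show ?thesis
    using f_eq_h g_eq_h' consecutive by simp
qed

lemma nadic_piecewise_differentiable:
  assumes f_pw: "nadic_piecewise N S f" and x_regular: "x \<in> {0..1}" "x \<notin> S"
  shows "f differentiable (at x within {0..1})"
proof -
  obtain r s h where consecutive: "r \<in> S" "s \<in> S" "x \<in> {r..s}"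
    and f_eq_h: "h \<in> nadic_affine N" "\<And>z. z \<in> {r..s} \<Longrightarrow> f z = h z"
    using nadic_piecewise_pieceE[OF f_pw x_regular(1)] by metis
  obtain k where "(h has_real_derivative real N powi k) (at x)"
    using has_real_derivative_nadic_affine[OF f_eq_h(1)] by metis
  then have "(f has_real_derivative real N powi k) (at x)"
  proof (rule has_field_derivative_transform_within_open)
    have "x \<noteq> r" "x \<noteq> s"
      using x_regular(2) consecutive by auto
    then show "x \<in> {r<..<s}"
      using consecutive(3) by auto
  qed (simp_all add: f_eq_h(2))
  then show ?thesis
    using has_field_derivative_at_within real_differentiable_def by blast
qed

lemma nadic_piecewise_derivative:
  assumes f_pw: "nadic_piecewise N S f" and x_unit: "x \<in> {0..1}"
    and differentiable: "f differentiable (at x within {0..1})"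
  shows "\<exists>k::int. (f has_real_derivative real N powi k) (at x within {0..1})"
proof -
  obtain r s h where consecutive: "r \<in> S" "s \<in> S" "r < s" "x \<in> {r..s}"
    and f_eq_h: "h \<in> nadic_affine N" "\<And>z. z \<in> {r..s} \<Longrightarrow> f z = h z"
    using nadic_piecewise_pieceE[OF f_pw x_unit] by metis
  obtain d where derivative_d: "(f has_real_derivative d) (at x within {0..1})"
    using differentiable by (auto simp: real_differentiable_def)
  have "{r..s} \<subseteq> {0..1}"
    using consecutive nadic_piecewiseD(4)[OF f_pw] by auto
  with derivative_d have "(f has_real_derivative d) (at x within {r..s})"
    by (rule has_field_derivative_subset)
  moreover obtain k where "(h has_real_derivative real N powi k) (at x within {r..s})"
    using has_real_derivative_nadic_affine[OF f_eq_h(1)] by metis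
  then have "(f has_real_derivative real N powi k) (at x within {r..s})"
    by (rule has_field_derivative_transform_within[where d = 1]) (use consecutive f_eq_h(2) in auto)
  moreover have "at x within {r..s} \<noteq> bot"
    using consecutive by (simp add: trivial_limit_within islimpt_Icc)
  ultimately have "d = real N powi k"
    unfolding has_field_derivative_iff by (auto intro: tendsto_unique)
  with derivative_d show ?thesis by blast
qed

lemma piecewise_linear_on_if_nadic_piecewise:
  assumes f_pw: "nadic_piecewise N S f"
  shows "piecewise_linear_on 0 1 f"
  unfolding piecewise_linear_on_def
proof (intro exI[of _ S] conjI allI impI)
  show "finite S"
    using nadic_piecewiseD(1)[OF f_pw] .
  fix u v :: real assume "0 \<le> u \<and> u < v \<and> v \<le> 1 \<and> {u<..<v} \<inter> S = {}"
  then obtain h where "h \<in> nadic_affine N" and f_eq_h: "\<And>x. x \<in> {u..v} \<Longrightarrow> f x = h x"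
    using nadic_piecewise_gapE[OF f_pw] by metis
  then obtain k c where "h = (\<lambda>x. real N powi k * x + c)"
    by (elim nadic_affineE)
  then have "\<forall>x\<in>{u<..<v}. f x = real N powi k * x + c"
    using f_eq_h by auto
  then show "\<exists>m c. \<forall>x\<in>{u<..<v}. f x = m * x + c" by blast
qed

lemma homeomorphism_restrict:
  assumes "homeomorphism S T f g"
  shows "homeomorphism S T (restrict f S) (restrict g T)"
  by (rule homeomorphism_cong[OF assms]) auto

lemma restrict_in_thompson_F:
  assumes homeo: "homeomorphism {0..1} {0..1} f g" and f_pw: "nadic_piecewise N S f"
  shows "restrict f {0..1} \<in> thompson_F N"
proof -
  let ?f = "restrict f {0..1}"
  have restrict_pw: "nadic_piecewise N S ?f"
    using f_pw by (rule nadic_piecewise_transform) simp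
  have nondiff: "{x \<in> {0..1}. \<not> ?f differentiable (at x within {0..1})} \<subseteq> S"
    using nadic_piecewise_differentiable[OF restrict_pw] by blast
  moreover have "\<exists>g. homeomorphism {0..1} {0..1} ?f g"
    using homeomorphism_restrict[OF homeo] by blast
  ultimately show ?thesis
    unfolding thompson_F_def
    using nadic_piecewise_derivative[OF restrict_pw]
      piecewise_linear_on_if_nadic_piecewise[OF restrict_pw]
      nadic_piecewiseD(1,3)[OF restrict_pw] finite_subset[OF nondiff]
    by auto
qed

lemma affine_if_countable_derivative:
  fixes f :: "real \<Rightarrow> real"
  assumes u_less_v: "u < v" and cont: "continuous_on {u..v} f" and countable_P: "countable P"
    and derivative_in_P: "\<And>x. u < x \<Longrightarrow> x < v \<Longrightarrow> \<exists>d\<in>P. (f has_real_derivative d) (at x)"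
  shows "\<exists>d\<in>P. \<forall>x\<in>{u..v}. f x - f u = d * (x - u)"
proof -
  define q where "q x = (f x - f u) / (x - u)" for x
  have q_in_P: "q x \<in> P" if x_mem: "x \<in> {u<..v}" for x
  proof -
    have "continuous_on {u..x} f"
      using cont by (rule continuous_on_subset) (use x_mem in auto)
    moreover have "f differentiable (at z)" if "u < z" "z < x" for z
      using derivative_in_P[of z] that x_mem by (auto simp: real_differentiable_def)
    ultimately obtain l z where z_between: "u < z" "z < x"
      and "(f has_real_derivative l) (at z)" "f x - f u = (x - u) * l"
      using MVT[of u x f] x_mem by auto
    moreover obtain d where "d \<in> P" "(f has_real_derivative d) (at z)"
      using derivative_in_P[of z] z_between x_mem by auto
    ultimately show ?thesis
      using DERIV_unique[of f d z l] x_mem by (simp add: q_def)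
  qed
  have "continuous_on {u<..v} q"
    unfolding q_def by (intro continuous_intros continuous_on_subset[OF cont]) auto
  then have "connected (q ` {u<..v})"
    by (intro connected_continuous_image) auto
  moreover have "countable (q ` {u<..v})"
    by (rule countable_subset[OF _ countable_P]) (use q_in_P in auto)
  ultimately have q_const: "q x = q v" if "x \<in> {u<..v}" for x
    using connected_uncountable[of "q ` {u<..v}" "q x" "q v"] that u_less_v by auto
  have "f x - f u = q v * (x - u)" if "x \<in> {u..v}" for x
    using q_const[of x] that by (cases "x = u") (simp_all add: q_def field_simps)
  moreover have "q v \<in> P"
    using q_in_P u_less_v by simp
  ultimately show ?thesis by blast
qed

definition breakpoints :: "(real \<Rightarrow> real) \<Rightarrow> real set" where
  "breakpoints f = {0, 1} \<union> {x \<in> {0..1}. \<not> f differentiable (at x within {0..1})}"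

lemma endpoints_subset_breakpoints: "{0, 1} \<subseteq> breakpoints f"
  by (simp add: breakpoints_def)

lemma breakpoints_subset_unit_interval: "breakpoints f \<subseteq> {0..1}"
  by (auto simp: breakpoints_def)

lemma
  assumes "f \<in> thompson_F N"
  shows finite_breakpoints: "finite (breakpoints f)"
    and breakpoints_subset_nadic_rationals: "breakpoints f \<subseteq> nadic_rationals N"
  using assms by (auto simp: breakpoints_def thompson_F_def)

lemma thompson_F_homeomorphismE:
  assumes "f \<in> thompson_F N"
  obtains g where "homeomorphism {0..1} {0..1} f g"
  using assms by (auto simp: thompson_F_def)

lemma
  assumes "f \<in> thompson_F N"
  shows thompson_F_continuous_on: "continuous_on {0..1} f"
    and thompson_F_inj_on: "inj_on f {0..1}"
    and thompson_F_image: "f ` {0..1} = {0..1}"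
  using assms unfolding thompson_F_def homeomorphism_def by (auto intro: inj_on_inverseI)

lemma thompson_F_affine_on_gap:
  assumes f_F: "f \<in> thompson_F N"
    and gap: "0 \<le> u" "u < v" "v \<le> 1" "{u<..<v} \<inter> breakpoints f = {}"
  obtains k :: int where "\<And>x. x \<in> {u..v} \<Longrightarrow> f x - f u = real N powi k * (x - u)"
proof -
  have "\<exists>d\<in>range (\<lambda>k::int. real N powi k). \<forall>x\<in>{u..v}. f x - f u = d * (x - u)"
  proof (rule affine_if_countable_derivative)
    show "continuous_on {u..v} f"
      by (rule continuous_on_subset[OF thompson_F_continuous_on[OF f_F]]) (use gap in auto)
    fix x assume x_between: "u < x" "x < v"
    then have "x \<notin> breakpoints f" "x \<in> {0..1}"
      using gap by auto
    then have "f differentiable (at x within {0..1})"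
      by (simp add: breakpoints_def)
    then obtain k :: int where "(f has_real_derivative real N powi k) (at x within {0..1})"
      using f_F \<open>x \<in> {0..1}\<close> unfolding thompson_F_def by blast
    moreover have "at x within {0..1} = at x"
      using x_between gap by (intro at_within_Icc_at) auto
    ultimately show "\<exists>d\<in>range (\<lambda>k::int. real N powi k). (f has_real_derivative d) (at x)"
      by auto
  qed (use gap in auto)
  then obtain k :: int where "\<forall>x\<in>{u..v}. f x - f u = real N powi k * (x - u)"
    by auto
  then show thesis
    by (intro that) (rule bspec)
qed

lemma thompson_F_strict_mono:
  assumes N_pos: "N > 0" and f_F: "f \<in> thompson_F N"
  shows "strict_mono_on {0..1} f"
proof (rule ccontr)
  assume "\<not> strict_mono_on {0..1} f"
  then have antimono: "strict_antimono_on {0..1} f"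
    using injective_eq_monotone_map[OF is_interval_cc thompson_F_continuous_on[OF f_F]]
      thompson_F_inj_on[OF f_F] by simp
  obtain r s where consecutive: "r \<in> breakpoints f" "s \<in> breakpoints f" "0 \<le> r" "r < s" "s \<le> 1"
    "{r<..<s} \<inter> breakpoints f = {}"
    by (rule finite_consecutive_around[of "breakpoints f" 0 1 0])
      (use finite_breakpoints[OF f_F] endpoints_subset_breakpoints[of f] in auto)
  obtain k :: int where "\<And>x. x \<in> {r..s} \<Longrightarrow> f x - f r = real N powi k * (x - r)"
    using thompson_F_affine_on_gap[OF f_F consecutive(3-6)] by metis
  then have "f s - f r > 0"
    using N_pos consecutive(4) by simp
  moreover have "f s < f r"
    using monotone_onD[OF antimono _ _ consecutive(4)] consecutive(3-5) by simp
  ultimately show False by simp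
qed

lemma thompson_F_endpoints:
  assumes N_pos: "N > 0" and f_F: "f \<in> thompson_F N"
  shows "f 0 = 0" "f 1 = 1"
proof -
  have mono: "mono_on {0..1} f"
    using thompson_F_strict_mono[OF N_pos f_F] by (rule strict_mono_on_imp_mono_on)
  have onto: "f ` {0..1} = {0..1}"
    using thompson_F_image[OF f_F] .
  then have "0 \<in> f ` {0..1}" "1 \<in> f ` {0..1}"
    by simp_all
  then obtain a b where "a \<in> {0..1}" "f a = 0" "b \<in> {0..1}" "f b = 1"
    by (elim imageE) metis
  then have "f 0 \<le> 0" "1 \<le> f 1"
    using mono_onD[OF mono, of 0 a] mono_onD[OF mono, of b 1] by auto
  moreover have "f 0 \<in> {0..1}" "f 1 \<in> {0..1}"
    using onto by auto
  ultimately show "f 0 = 0" "f 1 = 1" by auto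
qed

lemma thompson_F_breakpoint_value_nadic:
  assumes N_pos: "N > 0" and f_F: "f \<in> thompson_F N"
  shows "s \<in> breakpoints f \<Longrightarrow> f s \<in> nadic_rationals N"
proof (induction "card {t \<in> breakpoints f. t < s}" arbitrary: s rule: less_induct)
  case less
  let ?B = "{t \<in> breakpoints f. t \<le> s}"
  have finite_B: "finite (breakpoints f)"
    using finite_breakpoints[OF f_F] .
  have s_unit: "s \<in> {0..1}"
    using less.prems breakpoints_subset_unit_interval by blast
  show ?case
  proof (cases "s = 0")
    case True
    then show ?thesis
      using thompson_F_endpoints(1)[OF N_pos f_F] by simp
  next
    case False
    have "0 \<in> ?B" "s \<in> ?B"
      using s_unit less.prems endpoints_subset_breakpoints[of f] by auto
    then obtain r s' where "r \<in> ?B" "0 \<le> r" "r < s'" "s' \<le> s" "s \<in> {r..s'}" "{r<..<s'} \<inter> ?B = {}"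
      by (rule finite_consecutive_around[of ?B 0 s s, rotated]) (use finite_B s_unit False in auto)
    then have predecessor: "r \<in> breakpoints f" "0 \<le> r" "r < s" "{r<..<s} \<inter> breakpoints f = {}"
      by auto
    have "{t \<in> breakpoints f. t < r} \<subset> {t \<in> breakpoints f. t < s}"
      using predecessor by auto
    then have f_r_nadic: "f r \<in> nadic_rationals N"
      using finite_B predecessor(1) by (intro less.hyps psubset_card_mono) auto
    have "s \<le> 1"
      using s_unit by simp
    obtain k :: int where "\<And>x. x \<in> {r..s} \<Longrightarrow> f x - f r = real N powi k * (x - r)"
      using thompson_F_affine_on_gap[OF f_F predecessor(2,3) \<open>s \<le> 1\<close> predecessor(4)] by metis
    from this[of s] have "f s = f r + real N powi k * (s - r)"
      using predecessor(3) by (simp add: diff_eq_eq)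
    moreover have "r \<in> nadic_rationals N" "s \<in> nadic_rationals N"
      using predecessor(1) less.prems breakpoints_subset_nadic_rationals[OF f_F] by auto
    ultimately show ?thesis
      using N_pos f_r_nadic
        by (simp add: nadic_rationals_add nadic_rationals_mult_powi nadic_rationals_diff)
  qed
qed

lemma thompson_F_nadic_piecewise:
  assumes N_pos: "N > 0" and f_F: "f \<in> thompson_F N"
  shows "nadic_piecewise N (breakpoints f) f"
proof (rule nadic_piecewiseI)
  fix u v :: real
  assume gap: "0 \<le> u" "u < v" "v \<le> 1" "{u<..<v} \<inter> breakpoints f = {}"
  obtain r s where consecutive: "r \<in> breakpoints f" "s \<in> breakpoints f" "0 \<le> r" "r < s" "s \<le> 1"
    "(u + v) / 2 \<in> {r..s}" "{r<..<s} \<inter> breakpoints f = {}"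
    by (rule finite_consecutive_around[of "breakpoints f" 0 1 "(u + v) / 2"])
      (use finite_breakpoints[OF f_F] endpoints_subset_breakpoints[of f] gap in auto)
  have "r \<notin> {u<..<v}" "s \<notin> {u<..<v}"
    using consecutive(1,2) gap(4) by blast+
  then have uv_within_rs: "r \<le> u" "v \<le> s"
    using consecutive(6) gap(2) by auto
  obtain k :: int where slope: "\<And>x. x \<in> {r..s} \<Longrightarrow> f x - f r = real N powi k * (x - r)"
    using thompson_F_affine_on_gap[OF f_F consecutive(3-5,7)] by metis
  have "f r - real N powi k * r \<in> nadic_rationals N"
    using N_pos consecutive(1) thompson_F_breakpoint_value_nadic[OF N_pos f_F]
      breakpoints_subset_nadic_rationals[OF f_F]
    by (intro nadic_rationals_diff nadic_rationals_mult_powi) auto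
  moreover have "f x = real N powi k * x + (f r - real N powi k * r)" if "x \<in> {u..v}" for x
    using slope[of x] that uv_within_rs by (simp add: algebra_simps)
  ultimately show "\<exists>h\<in>nadic_affine N. \<forall>x\<in>{u..v}. f x = h x"
    by (rule nadic_affine_bexI)
qed (use endpoints_subset_breakpoints breakpoints_subset_unit_interval finite_breakpoints[OF f_F]
  breakpoints_subset_nadic_rationals[OF f_F] in auto)

section \<open>\<open>F(N)\<close> is a countable group\<close>

lemma thompson_F_id: "restrict (\<lambda>x. x) {0..1} \<in> thompson_F N"
proof (rule restrict_in_thompson_F)
  show "homeomorphism {0..1::real} {0..1} (\<lambda>x. x) (\<lambda>x. x)"
    by (simp add: homeomorphism_def)
  show "nadic_piecewise N {0, 1} (\<lambda>x. x)"
    by (intro nadic_piecewiseI nadic_affine_bexI[where k = 0 and c = 0]) auto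
qed

lemma nadic_piecewise_comp:
  assumes N_pos: "N > 0" and f_pw: "nadic_piecewise N S f" and g_pw: "nadic_piecewise N T g"
    and inj: "inj_on f {0..1}" and im: "f ` {0..1} \<subseteq> {0..1}"
  shows "nadic_piecewise N (S \<union> (f -` T \<inter> {0..1})) (g \<circ> f)"
proof (rule nadic_piecewiseI)
  show "finite (S \<union> (f -` T \<inter> {0..1}))"
    using nadic_piecewiseD(1)[OF f_pw] finite_vimage_IntI[OF nadic_piecewiseD(1)[OF g_pw] inj]
    by simp
  have "f -` T \<inter> {0..1} \<subseteq> nadic_rationals N"
    using nadic_piecewiseD(3)[OF g_pw] nadic_piecewise_in_nadic_rationals_iff[OF N_pos f_pw]
    by blast
  then show "S \<union> (f -` T \<inter> {0..1}) \<subseteq> nadic_rationals N"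
    using nadic_piecewiseD(3)[OF f_pw] by blast
next
  fix u v :: real
  assume gap: "0 \<le> u" "u < v" "v \<le> 1" "{u<..<v} \<inter> (S \<union> (f -` T \<inter> {0..1})) = {}"
  then have "{u<..<v} \<inter> S = {}" by blast
  then obtain h where f_eq_h: "h \<in> nadic_affine N" "\<And>x. x \<in> {u..v} \<Longrightarrow> f x = h x"
    using nadic_piecewise_gapE[OF f_pw gap(1-3)] by metis
  have mono: "strict_mono h"
    using strict_mono_nadic_affine[OF N_pos f_eq_h(1)] .
  have "f ` {u<..<v} \<inter> T = {}"
    using gap by (auto simp: disjoint_iff)
  moreover have "f ` {u<..<v} = {h u<..<h v}"
    using f_eq_h(2) nadic_affine_image_Ioo[OF N_pos f_eq_h(1), of u v]
    by (auto cong: image_cong_simp)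
  ultimately have "{h u<..<h v} \<inter> T = {}"
    by simp
  moreover have "f u \<in> {0..1}" "f v \<in> {0..1}"
    using im gap by (auto simp: image_subset_iff)
  then have "0 \<le> h u" "h v \<le> 1"
    using f_eq_h(2)[of u] f_eq_h(2)[of v] gap by auto
  ultimately obtain h' where g_eq_h': "h' \<in> nadic_affine N" "\<And>y. y \<in> {h u..h v} \<Longrightarrow> g y = h' y"
    using nadic_piecewise_gapE[OF g_pw _ strict_monoD[OF mono gap(2)]] by metis
  have "(g \<circ> f) x = (h' \<circ> h) x" if "x \<in> {u..v}" for x
    using f_eq_h(2)[OF that] g_eq_h'(2)[of "h x"] that strict_mono_less_eq[OF mono] by simp
  then show "\<exists>h\<in>nadic_affine N. \<forall>x\<in>{u..v}. (g \<circ> f) x = h x"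
    using nadic_affine_comp[OF N_pos g_eq_h'(1) f_eq_h(1)] by blast
qed (use nadic_piecewiseD[OF f_pw] in auto)

lemma strict_mono_on_homeomorphism_inverse:
  fixes f :: "'a::{linorder, topological_space} \<Rightarrow> 'b::{linorder, topological_space}"
  assumes homeo: "homeomorphism S T f g" and mono: "strict_mono_on S f"
  shows "strict_mono_on T g"
proof (rule strict_mono_onI)
  fix x y assume "x \<in> T" "y \<in> T" "x < y"
  moreover from this have "f (g x) = x" "f (g y) = y" "g x \<in> S" "g y \<in> S"
    using homeo unfolding homeomorphism_def by blast+
  ultimately show "g x < g y"
    using strict_mono_on_less[OF mono, of "g x" "g y"] by simp
qed

lemma nadic_piecewise_inverse:
  assumes N_pos: "N > 0" and f_pw: "nadic_piecewise N S f"
    and mono: "strict_mono_on {0..1} f" and endpoints: "f 0 = 0" "f 1 = 1"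
    and homeo: "homeomorphism {0..1} {0..1} f g"
  shows "nadic_piecewise N (f ` S) g"
proof (rule nadic_piecewiseI)
  have S_unit: "S \<subseteq> {0..1}"
    using nadic_piecewiseD(4)[OF f_pw] .
  show "f ` S \<subseteq> {0..1}"
    using homeo S_unit unfolding homeomorphism_def by blast
  show "f ` S \<subseteq> nadic_rationals N"
    using nadic_piecewiseD(3)[OF f_pw] nadic_piecewise_in_nadic_rationals_iff[OF N_pos f_pw] S_unit
    by blast
  show "{0, 1} \<subseteq> f ` S"
    using nadic_piecewiseD(2)[OF f_pw] endpoints by (auto intro: rev_image_eqI)
  fix u v :: real
  assume gap: "0 \<le> u" "u < v" "v \<le> 1" "{u<..<v} \<inter> f ` S = {}"
  have f_g: "f (g y) = y" "g y \<in> {0..1}" if "y \<in> {0..1}" for y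
    using homeo that unfolding homeomorphism_def by blast+
  have g_mono: "strict_mono_on {0..1} g"
    using strict_mono_on_homeomorphism_inverse[OF homeo mono] .
  have "f s \<in> {u<..<v}" if "s \<in> {g u<..<g v}" "s \<in> {0..1}" for s
    using that f_g[of u] f_g[of v] gap strict_mono_onD[OF mono, of "g u" s]
      strict_mono_onD[OF mono, of s "g v"] by auto
  then have "{g u<..<g v} \<inter> S = {}"
    using gap(4) S_unit by blast
  moreover have "g u < g v" "0 \<le> g u" "g v \<le> 1"
    using strict_mono_onD[OF g_mono, of u v] f_g(2)[of u] f_g(2)[of v] gap by auto
  ultimately obtain h where f_eq_h: "h \<in> nadic_affine N" "\<And>x. x \<in> {g u..g v} \<Longrightarrow> f x = h x"
    using nadic_piecewise_gapE[OF f_pw] by metis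
  obtain h' where h'_inverse: "h' \<in> nadic_affine N" "\<And>x. h' (h x) = x"
    using nadic_affine_inverse[OF N_pos f_eq_h(1)] by metis
  have "g y = h' y" if "y \<in> {u..v}" for y
  proof -
    have "g y \<in> {g u..g v}" "f (g y) = y"
      using that gap f_g strict_mono_on_less_eq[OF g_mono] by auto
    then show ?thesis
      using f_eq_h(2) h'_inverse(2) by metis
  qed
  then show "\<exists>h\<in>nadic_affine N. \<forall>y\<in>{u..v}. g y = h y"
    using h'_inverse(1) by blast
qed (use nadic_piecewiseD(1)[OF f_pw] in simp)

lemma thompson_F_comp:
  assumes N_pos: "N > 0" and f_F: "f \<in> thompson_F N" and g_F: "g \<in> thompson_F N"
  shows "restrict (g \<circ> f) {0..1} \<in> thompson_F N"
proof -
  obtain f' g' where "homeomorphism {0..1} {0..1} f f'" "homeomorphism {0..1} {0..1} g g'"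
    using f_F g_F by (metis thompson_F_homeomorphismE)
  then have "homeomorphism {0..1} {0..1} (g \<circ> f) (f' \<circ> g')"
    by (rule homeomorphism_compose)
  moreover have "nadic_piecewise N (breakpoints f \<union> (f -` breakpoints g \<inter> {0..1})) (g \<circ> f)"
    using N_pos f_F g_F thompson_F_inj_on[OF f_F] thompson_F_image[OF f_F]
    by (intro nadic_piecewise_comp thompson_F_nadic_piecewise) auto
  ultimately show ?thesis
    by (rule restrict_in_thompson_F)
qed

lemma thompson_F_inverse:
  assumes N_pos: "N > 0" and f_F: "f \<in> thompson_F N"
  obtains g where "g \<in> thompson_F N" "\<And>x. x \<in> {0..1} \<Longrightarrow> g (f x) = x"
proof -
  obtain g where homeo: "homeomorphism {0..1} {0..1} f g"
    using f_F by (rule thompson_F_homeomorphismE)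
  have "restrict g {0..1} \<in> thompson_F N"
    using homeomorphism_symD[OF homeo]
  proof (rule restrict_in_thompson_F)
    show "nadic_piecewise N (f ` breakpoints f) g"
      using N_pos f_F homeo thompson_F_endpoints[OF N_pos f_F]
      by (intro nadic_piecewise_inverse thompson_F_nadic_piecewise thompson_F_strict_mono)
  qed
  moreover have "restrict g {0..1} (f x) = x" if "x \<in> {0..1}" for x
    using homeo that by (force simp: homeomorphism_def)
  ultimately show thesis by (rule that)
qed

lemma thompson_orbit_relI:
  assumes "f \<in> thompson_F N" "x \<in> {0..1}"
  shows "(x, f x) \<in> thompson_orbit_rel N"
  using assms thompson_F_image[of f N] unfolding thompson_orbit_rel_def by blast

lemma thompson_orbit_relE:
  assumes "(x, y) \<in> thompson_orbit_rel N"
  obtains f where "f \<in> thompson_F N" "x \<in> {0..1}" "y \<in> {0..1}" "y = f x"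
  using assms unfolding thompson_orbit_rel_def by blast

lemma equiv_thompson_orbit_rel:
  assumes N_pos: "N > 0"
  shows "equiv {0..1} (thompson_orbit_rel N)"
proof (rule equivI)
  show "thompson_orbit_rel N \<subseteq> {0..1} \<times> {0..1}"
    by (auto simp: thompson_orbit_rel_def)
  show "refl_on {0..1} (thompson_orbit_rel N)"
  proof (rule refl_onI)
    fix x :: real assume "x \<in> {0..1}"
    then show "(x, x) \<in> thompson_orbit_rel N"
      using thompson_orbit_relI[OF thompson_F_id, of x N] by simp
  qed
  show "sym (thompson_orbit_rel N)"
  proof (rule symI)
    fix x y assume "(x, y) \<in> thompson_orbit_rel N"
    then obtain f where f_F: "f \<in> thompson_F N" and xy_mem: "x \<in> {0..1}" "y \<in> {0..1}" "y = f x"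
      by (rule thompson_orbit_relE)
    obtain g where "g \<in> thompson_F N" "g y = x"
      using thompson_F_inverse[OF N_pos f_F] xy_mem by metis
    then show "(y, x) \<in> thompson_orbit_rel N"
      using thompson_orbit_relI xy_mem(2) by blast
  qed
  show "trans (thompson_orbit_rel N)"
  proof (rule transI)
    fix x y z assume "(x, y) \<in> thompson_orbit_rel N" "(y, z) \<in> thompson_orbit_rel N"
    then obtain f g where f_F: "f \<in> thompson_F N" "x \<in> {0..1}" "y = f x"
      and g_F: "g \<in> thompson_F N" "z = g y"
      by (metis thompson_orbit_relE)
    then show "(x, z) \<in> thompson_orbit_rel N"
      using thompson_orbit_relI[OF thompson_F_comp[OF N_pos f_F(1) g_F(1)] f_F(2)] by simp
  qed
qed

lemma countable_thompson_F:
  assumes N_pos: "N > 0"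
  shows "countable (thompson_F N)"
proof (rule countable_image_inj_on)
  let ?G = "\<lambda>f. (\<lambda>s. (s, f s)) ` breakpoints f"
  have "?G ` thompson_F N \<subseteq> Fpow (nadic_rationals N \<times> nadic_rationals N)"
    using finite_breakpoints breakpoints_subset_nadic_rationals
      thompson_F_breakpoint_value_nadic[OF N_pos] by (force simp: Fpow_def)
  then show "countable (?G ` thompson_F N)"
    by (rule countable_subset) (intro countable_Fpow countable_SIGMA countable_nadic_rationals)
  show "inj_on ?G (thompson_F N)"
  proof (rule inj_onI)
    fix f g assume f_F: "f \<in> thompson_F N" and g_F: "g \<in> thompson_F N" and graph_eq: "?G f = ?G g"
    have "fst ` ?G f = fst ` ?G g"
      using graph_eq by simp
    then have breakpoints_eq: "breakpoints f = breakpoints g"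
      by (simp add: image_image)
    have "f s = g s" if "s \<in> breakpoints f" for s
      using graph_eq that by blast
    then have "f x = g x" if "x \<in> {0..1}" for x
      using nadic_piecewise_eqI[OF thompson_F_nadic_piecewise[OF N_pos f_F]] breakpoints_eq that
        thompson_F_nadic_piecewise[OF N_pos g_F] by metis
    then show "f = g"
      using f_F g_F by (intro extensionalityI[of f "{0..1}"]) (auto simp: thompson_F_def)
  qed
qed

section \<open>Standardness and quasi-preservation\<close>

lemma Image_thompson_orbit_rel:
  "A \<subseteq> {0..1} \<Longrightarrow> thompson_orbit_rel N `` A = (\<Union>f\<in>thompson_F N. f ` A)"
  using thompson_F_image unfolding thompson_orbit_rel_def by fast

lemma thompson_orbit_rel_eq_Union_graphs:
  "thompson_orbit_rel N = (\<Union>f\<in>thompson_F N. (\<lambda>x. (x, f x)) ` {0..1})"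
  using thompson_F_image unfolding thompson_orbit_rel_def by fast

lemma thompson_orbit_rel_borel:
  assumes N_pos: "N > 0"
  shows "thompson_orbit_rel N \<in> sets borel"
proof -
  have "compact ((\<lambda>x. (x, f x)) ` {0..1})" if "f \<in> thompson_F N" for f
    using thompson_F_continuous_on[OF that]
    by (intro compact_continuous_image continuous_intros) auto
  then show ?thesis
    unfolding thompson_orbit_rel_eq_Union_graphs
    using countable_thompson_F[OF N_pos] by (intro sets.countable_UN'') (auto intro: borel_compact)
qed

lemma space_unit_lebesgue: "space unit_lebesgue = {0..1}"
  by (simp add: unit_lebesgue_def space_restrict_space)

lemma borel_in_sets_pair_unit_lebesgue:
  assumes "R \<in> sets borel" "R \<subseteq> {0..1} \<times> {0..1}"
  shows "R \<in> sets (unit_lebesgue \<Otimes>\<^sub>M unit_lebesgue)" (is "R \<in> sets ?M")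
proof -
  have id_measurable: "(\<lambda>x. x) \<in> measurable unit_lebesgue borel"
    unfolding unit_lebesgue_def by (intro measurable_restrict_space1) simp
  have "(\<lambda>p. (fst p, snd p)) \<in> measurable ?M (borel \<Otimes>\<^sub>M borel)"
    by (intro measurable_Pair measurable_compose[OF measurable_fst id_measurable]
        measurable_compose[OF measurable_snd id_measurable])
  then have "(\<lambda>p. p) \<in> measurable ?M borel"
    by (simp add: borel_prod)
  from measurable_sets[OF this assms(1)] have "R \<inter> space ?M \<in> sets ?M"
    by simp
  then show ?thesis
    using assms(2) by (simp add: space_pair_measure space_unit_lebesgue Int_absorb2)
qed

lemma standard_thompson_orbit_rel:
  assumes N_pos: "N > 0"
  shows "standard_rel unit_lebesgue (thompson_orbit_rel N)"
  unfolding standard_rel_def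
proof
  have "countable (thompson_orbit_rel N `` {x})" if "x \<in> {0..1}" for x
    using that countable_thompson_F[OF N_pos] by (simp add: Image_thompson_orbit_rel)
  then show "AE x in unit_lebesgue. countable (thompson_orbit_rel N `` {x})"
    by (intro AE_I2) (simp add: space_unit_lebesgue)
  show "thompson_orbit_rel N \<in> sets (unit_lebesgue \<Otimes>\<^sub>M unit_lebesgue)"
    using thompson_orbit_rel_borel[OF N_pos] equiv_type[OF equiv_thompson_orbit_rel[OF N_pos]]
    by (rule borel_in_sets_pair_unit_lebesgue)
qed

lemma null_sets_completion_restrict_space:
  assumes Omega_sets: "\<Omega> \<in> sets M"
  shows "A \<in> null_sets (completion (restrict_space M \<Omega>)) \<longleftrightarrow>
    A \<subseteq> \<Omega> \<and> A \<in> null_sets (completion M)"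
proof
  assume "A \<in> null_sets (completion (restrict_space M \<Omega>))"
  then obtain B where "B \<in> null_sets (restrict_space M \<Omega>)" "A \<subseteq> B"
    by (auto simp: null_sets_completion_iff2)
  then show "A \<subseteq> \<Omega> \<and> A \<in> null_sets (completion M)"
    by (auto simp: null_sets_restrict_space[OF Omega_sets] null_sets_completion_iff2)
next
  assume A_null: "A \<subseteq> \<Omega> \<and> A \<in> null_sets (completion M)"
  then obtain B where A_subset_B: "B \<in> null_sets M" "A \<subseteq> B"
    by (auto simp: null_sets_completion_iff2)
  then have "B \<inter> \<Omega> \<in> null_sets (restrict_space M \<Omega>)"
    using Omega_sets by (simp add: null_sets_restrict_space null_set_Int2)
  moreover have "A \<subseteq> B \<inter> \<Omega>"
    using A_null A_subset_B by blast
  ultimately show "A \<in> null_sets (completion (restrict_space M \<Omega>))"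
    unfolding null_sets_completion_iff2 ..
qed

lemma null_sets_completion_unit_lebesgue:
  "A \<in> null_sets (completion unit_lebesgue) \<longleftrightarrow> A \<subseteq> {0..1} \<and> negligible A"
  by (simp add: unit_lebesgue_def null_sets_completion_restrict_space negligible_iff_null_sets)

lemma negligible_image_if_differentiable_off_finite:
  fixes f :: "'a::euclidean_space \<Rightarrow> 'b::euclidean_space"
  assumes "DIM('a) \<le> DIM('b)" "negligible A" "finite S" "f differentiable_on (A - S)"
  shows "negligible (f ` A)"
proof -
  have "negligible (f ` (A - S))"
    using assms(1) negligible_diff[OF assms(2)] assms(4)
    by (rule negligible_differentiable_image_negligible)
  moreover have "negligible (f ` S)"
    using assms(3) by (intro negligible_finite) simp
  ultimately have "negligible (f ` (A - S) \<union> f ` S)"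
    by (rule negligible_Un)
  then show ?thesis
    by (rule negligible_subset) blast
qed

lemma negligible_image_thompson_F:
  assumes f_F: "f \<in> thompson_F N" and "negligible A" "A \<subseteq> {0..1}"
  shows "negligible (f ` A)"
proof (rule negligible_image_if_differentiable_off_finite)
  show "finite (breakpoints f)"
    using finite_breakpoints[OF f_F] .
  show "f differentiable_on (A - breakpoints f)"
    unfolding differentiable_on_def
  proof
    fix x assume "x \<in> A - breakpoints f"
    then have "f differentiable (at x within {0..1})"
      using assms(3) by (auto simp: breakpoints_def)
    then show "f differentiable (at x within A - breakpoints f)"
      by (rule differentiable_within_subset) (use assms(3) in auto)
  qed
qed (use assms in simp_all)

lemma quasi_preserving_thompson_orbit_rel:
  assumes N_pos: "N > 0"
  shows "quasi_preserving_rel unit_lebesgue (thompson_orbit_rel N)"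
  unfolding quasi_preserving_rel_def null_sets_completion_unit_lebesgue
proof (intro ballI conjI)
  fix A :: "real set" assume "A \<in> null_sets (completion unit_lebesgue)"
  then have A_null: "A \<subseteq> {0..1}" "negligible A"
    by (simp_all add: null_sets_completion_unit_lebesgue)
  show "thompson_orbit_rel N `` A \<subseteq> {0..1}"
    by (auto simp: thompson_orbit_rel_def)
  have "negligible (\<Union>f\<in>thompson_F N. f ` A)"
    using A_null countable_thompson_F[OF N_pos]
    by (intro negligible_countable_Union) (auto intro: negligible_image_thompson_F)
  then show "negligible (thompson_orbit_rel N `` A)"
    by (simp add: Image_thompson_orbit_rel[OF A_null(1)])
qed

section \<open>Ergodicity\<close>

lemma strict_mono_on_homeomorphism_Icc:
  fixes f :: "real \<Rightarrow> real"
  assumes "a \<le> b" and cont: "continuous_on {a..b} f" and mono: "strict_mono_on {a..b} f"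
  obtains g where "homeomorphism {a..b} {f a..f b} f g"
proof -
  have "f ` {a..b} = {f a..f b}"
  proof (intro equalityI subsetI)
    fix y assume "y \<in> {f a..f b}"
    then obtain x where "a \<le> x" "x \<le> b" "f x = y"
      using IVT'[of f a y b] assms by auto
    then show "y \<in> f ` {a..b}"
      by auto
  next
    fix y assume "y \<in> f ` {a..b}"
    then show "y \<in> {f a..f b}"
      using \<open>a \<le> b\<close> by (auto simp: strict_mono_on_leD[OF mono])
  qed
  then show thesis
    using homeomorphism_compact[OF compact_Icc cont _ strict_mono_on_imp_inj_on[OF mono]] that
    by blast
qed

definition shift_map :: "real \<Rightarrow> real \<Rightarrow> real \<Rightarrow> real" where
  "shift_map n p x = min (n * x) (min (x + (n - 1) * p) (1 - (1 - x) / n))"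

context
  fixes n p :: real
  assumes n_gt_1: "n > 1" and p_bounds: "0 < p" "p < 1 - n * p"
begin

lemma strict_mono_shift_map: "strict_mono (shift_map n p)"
proof (rule strict_monoI)
  fix x y :: real assume "x < y"
  moreover from this have "n * x < n * y" "(1 - y) / n < (1 - x) / n"
    using n_gt_1 by (auto simp: divide_strict_right_mono)
  ultimately show "shift_map n p x < shift_map n p y"
    by (auto simp: shift_map_def min_def)
qed

lemma shift_map_left:
  assumes x_left: "x \<le> p"
  shows "shift_map n p x = n * x"
proof -
  have "(n - 1) * x \<le> (n - 1) * p" "(n + 1) * x \<le> (n + 1) * p"
    using x_left n_gt_1 by (auto intro!: mult_left_mono)
  then have "(n - 1) * x \<le> (n - 1) * p" "(n + 1) * x \<le> 1"
    using p_bounds by (auto simp: algebra_simps)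
  moreover from this(2) have "(n - 1) * ((n + 1) * x) \<le> (n - 1) * 1"
    using n_gt_1 by (intro mult_left_mono) auto
  ultimately show ?thesis
    using n_gt_1 by (auto simp: shift_map_def min_def field_simps)
qed

lemma shift_map_middle:
  assumes x_middle: "p \<le> x" "x \<le> 1 - n * p"
  shows "shift_map n p x = x + (n - 1) * p"
proof -
  have "(n - 1) * p \<le> (n - 1) * x" "(n - 1) * (n * p) \<le> (n - 1) * (1 - x)"
    using x_middle n_gt_1 by (auto intro!: mult_left_mono)
  then show ?thesis
    using n_gt_1 by (auto simp: shift_map_def min_def field_simps)
qed

lemma shift_map_right:
  assumes x_right: "1 - n * p \<le> x"
  shows "shift_map n p x = 1 - (1 - x) / n"
proof -
  have "(n - 1) * (1 - x) \<le> (n - 1) * (n * p)" "(n - 1) * p \<le> (n - 1) * x"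
    using x_right p_bounds n_gt_1 by (auto intro!: mult_left_mono)
  then have "1 - (1 - x) / n \<le> x + (n - 1) * p" "x + (n - 1) * p \<le> n * x"
    using n_gt_1 by (simp_all add: field_simps)
  then show ?thesis
    by (auto simp: shift_map_def min_def)
qed

lemma homeomorphism_shift_map:
  obtains g where "homeomorphism {0..1} {0..1} (shift_map n p) g"
proof -
  have "continuous_on {0..1} (shift_map n p)"
    unfolding shift_map_def using n_gt_1 by (intro continuous_intros) auto
  moreover have "strict_mono_on {0..1} (shift_map n p)"
    using strict_mono_shift_map by (simp add: monotone_on_def)
  moreover have "shift_map n p 0 = 0" "shift_map n p 1 = 1"
    using n_gt_1 p_bounds shift_map_left[of 0] shift_map_right[of 1] by auto
  ultimately show thesis
    using strict_mono_on_homeomorphism_Icc[of 0 1 "shift_map n p"] that by auto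
qed

end

lemma nadic_piecewise_shift_map:
  assumes N_ge_2: "N \<ge> 2" and p_bounds: "p \<in> nadic_rationals N" "0 < p" "p < 1 - real N * p"
  shows "nadic_piecewise N {0, p, 1 - real N * p, 1} (shift_map (real N) p)"
proof (rule nadic_piecewiseI)
  have Np_nadic: "real N * p \<in> nadic_rationals N"
    using nadic_rationals_mult_powi[of N p 1] p_bounds(1) N_ge_2 by simp
  then show "{0, p, 1 - real N * p, 1} \<subseteq> nadic_rationals N"
    using p_bounds N_ge_2 by (simp add: nadic_rationals_diff)
  have "0 < real N * p"
    using p_bounds N_ge_2 by simp
  then show "{0, p, 1 - real N * p, 1} \<subseteq> {0..1}"
    using p_bounds by auto
  have N_gt_1: "real N > 1"
    using N_ge_2 by simp
  fix u v :: real
  assume gap: "0 \<le> u" "u < v" "v \<le> 1" "{u<..<v} \<inter> {0, p, 1 - real N * p, 1} = {}"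
  then consider (left) "v \<le> p" | (middle) "p \<le> u" "v \<le> 1 - real N * p"
    | (right) "1 - real N * p \<le> u"
    using p_bounds(3) by fastforce
  then show "\<exists>h\<in>nadic_affine N. \<forall>x\<in>{u..v}. shift_map (real N) p x = h x"
  proof cases
    case left
    then show ?thesis
      using shift_map_left[OF N_gt_1 p_bounds(2,3)]
      by (intro nadic_affine_bexI[where k = 1 and c = 0]) auto
  next
    case middle
    have "real N * p - p \<in> nadic_rationals N"
      using Np_nadic p_bounds(1) N_ge_2 by (simp add: nadic_rationals_diff)
    then show ?thesis
      using middle shift_map_middle[OF N_gt_1 p_bounds(2,3)]
      by (intro nadic_affine_bexI[where k = 0 and c = "real N * p - p"]) (auto simp: algebra_simps)
  next
    case right
    have "1 - real N powi (- 1) * 1 \<in> nadic_rationals N"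
      using N_ge_2 by (intro nadic_rationals_diff nadic_rationals_mult_powi) auto
    then show ?thesis
      using right N_ge_2 shift_map_right[OF N_gt_1 p_bounds(2,3)]
      by (intro nadic_affine_bexI[where k = "- 1" and c = "1 - real N powi (- 1) * 1"])
        (auto simp: field_simps)
  qed
qed simp_all

lemma thompson_orbit_rel_shift:
  assumes N_ge_2: "N \<ge> 2" and p_bounds: "p \<in> nadic_rationals N" "0 < p"
    and x_bounds: "p < x" "x < 1 - real N * p"
  shows "(x, x + (real N - 1) * p) \<in> thompson_orbit_rel N"
proof -
  have N_gt_1: "real N > 1" and p_gap: "p < 1 - real N * p"
    using N_ge_2 x_bounds by simp_all
  obtain g where "homeomorphism {0..1} {0..1} (shift_map (real N) p) g"
    using homeomorphism_shift_map[OF N_gt_1 p_bounds(2) p_gap] .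
  then have "restrict (shift_map (real N) p) {0..1} \<in> thompson_F N"
    using nadic_piecewise_shift_map[OF N_ge_2 p_bounds p_gap] by (rule restrict_in_thompson_F)
  moreover have "0 < real N * p"
    using N_gt_1 p_bounds by simp
  then have "x \<in> {0..1}"
    using p_bounds x_bounds by simp
  ultimately have "(x, restrict (shift_map (real N) p) {0..1} x) \<in> thompson_orbit_rel N"
    by (rule thompson_orbit_relI)
  then show ?thesis
    using \<open>x \<in> {0..1}\<close> shift_map_middle[OF N_gt_1 p_bounds(2) p_gap, of x] x_bounds by simp
qed

lemma thompson_orbit_rel_iterated_shift:
  assumes N_ge_2: "N \<ge> 2" and p_bounds: "p \<in> nadic_rationals N" "0 < p" "p < x"
  shows "x + real i * ((real N - 1) * p) < 1 - p \<Longrightarrow>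
    (x, x + real i * ((real N - 1) * p)) \<in> thompson_orbit_rel N"
proof (induction i)
  case 0
  then show ?case
    using p_bounds equiv_thompson_orbit_rel[of N] N_ge_2 by (simp add: equiv_def refl_on_def)
next
  case (Suc i)
  let ?z = "x + real i * ((real N - 1) * p)"
  have z_Suc: "x + real (Suc i) * ((real N - 1) * p) = ?z + (real N - 1) * p"
    by (simp add: algebra_simps)
  have "0 \<le> (real N - 1) * p"
    using p_bounds N_ge_2 by simp
  moreover from this have "0 \<le> real i * ((real N - 1) * p)"
    by simp
  ultimately have z_bounds: "?z < 1 - p" "p < ?z"
    using Suc.prems p_bounds unfolding z_Suc by linarith+
  have "?z < 1 - real N * p"
    using Suc.prems unfolding z_Suc by (simp add: algebra_simps)
  then have "(?z, ?z + (real N - 1) * p) \<in> thompson_orbit_rel N"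
    using thompson_orbit_rel_shift[OF N_ge_2 p_bounds(1,2) z_bounds(2)] by blast
  moreover have "trans (thompson_orbit_rel N)"
    using equiv_thompson_orbit_rel[of N] N_ge_2 by (simp add: equiv_def)
  ultimately show ?case
    using Suc.IH[OF z_bounds(1)] unfolding z_Suc by (blast dest: transD)
qed

lemma thompson_orbit_rel_translation:
  assumes N_ge_2: "N \<ge> 2" and q_pos: "q \<in> nadic_rationals N" "0 < q"
    and x_bounds: "0 < x" "x + (real N - 1) * q < 1"
  shows "(x, x + (real N - 1) * q) \<in> thompson_orbit_rel N"
proof -
  define y where "y = x + (real N - 1) * q"
  define e where "e = min x (1 - y)"
  have "e > 0"
    using x_bounds by (simp add: e_def y_def)
  obtain r where r_large: "q / e < real N ^ r"
    using real_arch_pow[of "real N" "q / e"] N_ge_2 by auto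
  define p where "p = q / real N ^ r"
  have "p = real N powi (- int r) * q"
    by (simp add: p_def power_int_minus field_simps)
  then have p_nadic: "p \<in> nadic_rationals N"
    using nadic_rationals_mult_powi[of N q "- int r"] q_pos N_ge_2 by simp
  have p_pos: "0 < p" and "p < e"
    using q_pos r_large \<open>e > 0\<close> N_ge_2 by (auto simp: p_def field_simps)
  then have p_less: "p < x" "y < 1 - p"
    by (simp_all add: e_def)
  have "real (N ^ r) * ((real N - 1) * p) = (real N - 1) * q"
    using N_ge_2 by (simp add: p_def)
  then show ?thesis
    using thompson_orbit_rel_iterated_shift[OF N_ge_2 p_nadic p_pos p_less(1), of "N ^ r"] p_less(2)
    unfolding y_def by metis
qed

text \<open>By additivity the deviation from linearity doubles from \<open>x\<close> to \<open>2 x\<close> on \<open>[0, 1/2]\<close> and is odd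
  under \<open>x \<mapsto> 1 - x\<close>, so its maximum can only be \<open>0\<close>.\<close>

lemma linear_if_additive_on_unit_interval:
  fixes F :: "real \<Rightarrow> 'a::real_normed_vector"
  assumes cont: "continuous_on {0..1} F"
    and additive: "\<And>x y. 0 \<le> x \<Longrightarrow> 0 \<le> y \<Longrightarrow> x + y \<le> 1 \<Longrightarrow> F (x + y) = F x + F y"
    and x_unit: "x \<in> {0..1}"
  shows "F x = x *\<^sub>R F 1"
proof -
  define G where "G t = F t - t *\<^sub>R F 1" for t
  have G_add: "G (s + t) = G s + G t" if "0 \<le> s" "0 \<le> t" "s + t \<le> 1" for s t
    using additive[OF that] by (simp add: G_def algebra_simps)
  have "continuous_on {0..1} (\<lambda>t. norm (G t))"
    unfolding G_def by (intro continuous_intros cont)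
  then obtain z where z_unit: "z \<in> {0..1}" and z_max: "\<And>t. t \<in> {0..1} \<Longrightarrow> norm (G t) \<le> norm (G z)"
    using continuous_attains_sup[of "{0..1}" "\<lambda>t. norm (G t)"] by auto
  obtain w where w_half: "0 \<le> w" "w \<le> 1 / 2" "norm (G w) = norm (G z)"
  proof (cases "z \<le> 1 / 2")
    case False
    have "G z + G (1 - z) = G 1"
      using G_add[of z "1 - z"] z_unit by simp
    also have "\<dots> = 0"
      by (simp add: G_def)
    finally have "norm (G (1 - z)) = norm (G z)"
      by (simp add: add_eq_0_iff)
    then show thesis
      using that[of "1 - z"] False z_unit by simp
  qed (use that[of z] z_unit in simp)
  have "2 * norm (G w) = norm (G (w + w))"
    using G_add[of w w] w_half by (simp flip: scaleR_2)
  also have "\<dots> \<le> norm (G w)"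
    using z_max[of "w + w"] w_half by simp
  finally have "norm (G z) = 0"
    using w_half(3) by simp
  then have "G x = 0"
    using z_max[OF x_unit] by simp
  then show ?thesis
    by (simp add: G_def)
qed

lemma real_distribution_uniform_measure:
  assumes "emeasure lborel A \<noteq> 0" "emeasure lborel A \<noteq> \<infinity>"
  shows "real_distribution (uniform_measure lborel A)"
  using prob_space_uniform_measure[OF assms]
  by (simp add: real_distribution_def real_distribution_axioms_def)

lemma cdf_uniform_measure_unit_interval:
  "cdf (uniform_measure lborel {0..1}) x = max 0 (min 1 x)"
proof -
  have "{0..1} \<inter> {..x} = {0..min 1 x}"
    by auto
  then show ?thesis
    by (auto simp: cdf_def)
qed

context real_distribution
begin

lemma cdf_supported_unit_interval:
  assumes supp: "measure M {0..1} = 1" and no_atom: "measure M {0} = 0"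
  shows "x \<le> 0 \<Longrightarrow> cdf M x = 0" "1 \<le> x \<Longrightarrow> cdf M x = 1"
proof -
  have "{0..1} = {0} \<union> {0<..1::real}"
    by auto
  then have "measure M {0<..1} = 1"
    using supp no_atom finite_measure_Union[of "{0}" "{0<..1}"] by simp
  then have "cdf M 1 - cdf M 0 = 1"
    using cdf_diff_eq[of 0 1] by simp
  then have cdf_ends: "cdf M 0 \<le> 0" "1 \<le> cdf M 1"
    using cdf_nonneg[of 0] cdf_bounded_prob[of 1] by auto
  show "cdf M x = 0" if "x \<le> 0"
    using cdf_nondecreasing[OF that] cdf_nonneg[of x] cdf_ends(1) by simp
  show "cdf M x = 1" if "1 \<le> x"
    using cdf_nondecreasing[OF that] cdf_bounded_prob[of x] cdf_ends(2) by simp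
qed

context
  fixes D
  assumes no_atoms: "\<And>x. measure M {x} = 0" and dense: "closure D = UNIV"
    and translation: "\<And>d t. d \<in> D \<Longrightarrow> 0 < d \<Longrightarrow> 0 < t \<Longrightarrow> d + t < 1 \<Longrightarrow>
      measure M {d<..d + t} = measure M {0<..t}"
begin

lemma cdf_increment_eq_if_dense_translations:
  assumes "0 \<le> x" "0 \<le> t" "x + t \<le> 1"
  shows "cdf M (x + t) - cdf M x = cdf M t - cdf M 0"
proof (cases "t = 0 \<or> t = 1")
  case False
  have cont: "isCont (cdf M) y" for y
    by (simp add: isCont_cdf no_atoms)
  have closure: "closure ({0<..<1 - t} \<inter> D) = {0..1 - t}"
    using False assms dense by (subst closure_open_Int_superset) auto
  show ?thesis
  proof (rule continuous_constant_on_closure[where f = "\<lambda>x. cdf M (x + t) - cdf M x"])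
    show "continuous_on (closure ({0<..<1 - t} \<inter> D)) (\<lambda>x. cdf M (x + t) - cdf M x)"
      by (intro continuous_at_imp_continuous_on ballI continuous_intros isCont_o2[OF _ cont])
    show "x \<in> closure ({0<..<1 - t} \<inter> D)"
      using assms by (simp add: closure)
    fix d assume "d \<in> {0<..<1 - t} \<inter> D"
    then have "measure M {d<..d + t} = measure M {0<..t}"
      using translation False assms by auto
    then show "cdf M (d + t) - cdf M d = cdf M t - cdf M 0"
      using cdf_diff_eq[of d "d + t"] cdf_diff_eq[of 0 t] False assms by simp
  qed
qed (use assms in auto)

lemma eq_uniform_measure_if_dense_translations:
  assumes supp: "measure M {0..1} = 1"
  shows "M = uniform_measure lborel {0..1}"
proof (rule cdf_unique)
  show "real_distribution M" ..
  show "real_distribution (uniform_measure lborel {0..1})"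
    by (rule real_distribution_uniform_measure) simp_all
  note cdf_outside = cdf_supported_unit_interval[OF supp no_atoms]
  have cdf_inside: "cdf M x = x" if "x \<in> {0..1}" for x
  proof -
    have "cdf M x = x *\<^sub>R cdf M 1"
    proof (rule linear_if_additive_on_unit_interval[OF _ _ that])
      show "continuous_on {0..1} (cdf M)"
        by (intro continuous_at_imp_continuous_on ballI) (simp add: isCont_cdf no_atoms)
      fix s t :: real assume "0 \<le> s" "0 \<le> t" "s + t \<le> 1"
      then show "cdf M (s + t) = cdf M s + cdf M t"
        using cdf_increment_eq_if_dense_translations[of s t] cdf_outside(1)[of 0] by simp
    qed
    then show ?thesis
      by (simp add: cdf_outside(2))
  qed
  have "cdf M x = max 0 (min 1 x)" for x
    using cdf_inside[of x] cdf_outside[of x] by (auto simp: max_def min_def)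
  then show "cdf M = cdf (uniform_measure lborel {0..1})"
    by (simp add: fun_eq_iff cdf_uniform_measure_unit_interval)
qed

end

end

lemma measure_Int_Ioc_translation:
  fixes A :: "real set"
  assumes A_borel: "A \<in> sets borel"
    and translation: "\<And>z. a < z \<Longrightarrow> z \<le> b \<Longrightarrow> z \<in> A \<longleftrightarrow> c + z \<in> A"
  shows "measure lborel (A \<inter> {c + a<..c + b}) = measure lborel (A \<inter> {a<..b})"
proof -
  have "(+) c ` (A \<inter> {a<..b}) = A \<inter> {c + a<..c + b}"
  proof (intro equalityI subsetI)
    fix w assume "w \<in> A \<inter> {c + a<..c + b}"
    then have "w - c \<in> A \<inter> {a<..b}"
      using translation[of "w - c"] by auto
    then show "w \<in> (+) c ` (A \<inter> {a<..b})"
      by (intro image_eqI[of _ _ "w - c"]) auto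
  qed (use translation in auto)
  then have "measure lebesgue (A \<inter> {c + a<..c + b}) = measure lebesgue (A \<inter> {a<..b})"
    by (metis measure_translation)
  then show ?thesis
    using A_borel by (simp add: measure_completion)
qed

lemma measure_uniform_measure_lborel_singleton:
  fixes A :: "'a::euclidean_space set"
  assumes A_pos_finite: "emeasure lborel A \<noteq> 0" "emeasure lborel A \<noteq> \<infinity>"
  shows "measure (uniform_measure lborel A) {x} = 0"
proof -
  have "A \<inter> {x} \<in> null_sets lborel"
    using emeasure_neq_0_sets[OF A_pos_finite(1)] by (intro null_set_Int1) auto
  then show ?thesis
    using A_pos_finite by (simp add: measure_eq_0_null_sets)
qed

lemma measure_uniform_measure_superset:
  assumes A_pos_finite: "emeasure M A \<noteq> 0" "emeasure M A \<noteq> \<infinity>" and "A \<subseteq> B" "B \<in> sets M"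
  shows "measure (uniform_measure M A) B = 1"
proof -
  have "measure M A \<noteq> 0"
    using emeasure_eq_ennreal_measure[of M A] A_pos_finite by auto
  then show ?thesis
    using assms by (simp add: Int_absorb2)
qed

lemma emeasure_eq_1_if_dense_translations:
  fixes A :: "real set"
  assumes A_borel: "A \<in> sets borel" "A \<subseteq> {0..1}" and dense: "closure D = UNIV"
    and translation: "\<And>d x. d \<in> D \<Longrightarrow> 0 < d \<Longrightarrow> 0 < x \<Longrightarrow> d + x < 1 \<Longrightarrow> x \<in> A \<longleftrightarrow> d + x \<in> A"
    and pos: "emeasure lborel A \<noteq> 0"
  shows "emeasure lborel A = 1"
proof -
  have "emeasure lborel A \<le> emeasure lborel {0..1::real}"
    using A_borel by (intro emeasure_mono) auto
  then have not_inf: "emeasure lborel A \<noteq> \<infinity>"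
    by (auto simp: top_unique)
  let ?M = "uniform_measure lborel A"
  interpret M: real_distribution ?M
    using pos not_inf by (rule real_distribution_uniform_measure)
  have "?M = uniform_measure lborel {0..1}"
  proof (rule M.eq_uniform_measure_if_dense_translations[OF _ dense])
    show "measure ?M {x} = 0" for x
      using pos not_inf by (rule measure_uniform_measure_lborel_singleton)
    show "measure ?M {0..1} = 1"
      using pos not_inf A_borel(2) by (rule measure_uniform_measure_superset) simp
    fix d t assume "d \<in> D" "0 < d" "0 < t" "d + t < 1"
    then have "measure lborel (A \<inter> {d + 0<..d + t}) = measure lborel (A \<inter> {0<..t})"
      using translation by (intro measure_Int_Ioc_translation[OF A_borel(1)]) auto
    then show "measure ?M {d<..d + t} = measure ?M {0<..t}"
      using pos not_inf by simp
  qed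
  then have "emeasure ?M A = emeasure (uniform_measure lborel {0..1}) A"
    by simp
  moreover have "{0..1} \<inter> A = A"
    using A_borel by blast
  ultimately show ?thesis
    using A_borel emeasure_uniform_measure_1[OF pos not_inf] by (simp add: divide_ennreal_def)
qed

lemma quotient_Union_saturated:
  assumes equiv_R: "equiv X R" and C_classes: "C \<subseteq> X // R" and xy_related: "(x, y) \<in> R"
  shows "x \<in> \<Union>C \<longleftrightarrow> y \<in> \<Union>C"
proof -
  have "w \<in> \<Union>C" if "z \<in> \<Union>C" "(z, w) \<in> R" for z w
    using that C_classes in_quotient_imp_closed[OF equiv_R] by blast
  moreover have "(y, x) \<in> R"
    using xy_related equiv_R by (meson equivE symD)
  ultimately show ?thesis
    using xy_related by blast
qed

lemma ergodic_thompson_orbit_rel: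
  assumes N_ge_2: "N \<ge> 2"
  shows "ergodic_rel unit_lebesgue (thompson_orbit_rel N)"
  unfolding ergodic_rel_def
proof (intro ballI impI)
  let ?D = "(*\<^sub>R) (real N - 1) ` nadic_rationals N"
  fix A assume "A \<in> sets unit_lebesgue"
    and "\<exists>C\<subseteq>space unit_lebesgue // thompson_orbit_rel N. A = \<Union>C"
  then obtain C where C_classes: "C \<subseteq> {0..1} // thompson_orbit_rel N" "A = \<Union>C"
    and A_borel: "A \<in> sets borel" "A \<subseteq> {0..1}"
    by (auto simp: space_unit_lebesgue) (auto simp: unit_lebesgue_def sets_restrict_space_iff)
  have "closure ?D = range ((*\<^sub>R) (real N - 1))"
    unfolding closure_scaleR[symmetric] closure_nadic_rationals[OF N_ge_2] ..
  also have "\<dots> = UNIV"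
    using N_ge_2 by (auto intro!: surjI[of _ "\<lambda>x. x / (real N - 1)"])
  finally have dense: "closure ?D = UNIV" .
  have "x \<in> A \<longleftrightarrow> d + x \<in> A" if "d \<in> ?D" "0 < d" "0 < x" "d + x < 1" for d x
  proof -
    obtain q where d_eq: "q \<in> nadic_rationals N" "d = (real N - 1) * q"
      using \<open>d \<in> ?D\<close> by auto
    then have "0 < q"
      using \<open>0 < d\<close> N_ge_2 by (simp add: zero_less_mult_iff)
    then have "(x, d + x) \<in> thompson_orbit_rel N"
      using thompson_orbit_rel_translation[OF N_ge_2 d_eq(1), of x] that(3,4) d_eq(2)
      by (simp add: add.commute)
    then show ?thesis
      using quotient_Union_saturated[OF equiv_thompson_orbit_rel C_classes(1)] C_classes(2) N_ge_2
      by simp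
  qed
  then have "emeasure lborel A = 0 \<or> emeasure lborel A = 1"
    using emeasure_eq_1_if_dense_translations[OF A_borel dense] by blast
  then show "emeasure unit_lebesgue A = 0 \<or> emeasure unit_lebesgue A = 1"
    using A_borel by (simp add: unit_lebesgue_def emeasure_restrict_space)
qed

theorem mainTheorem2:
  fixes N :: nat
  assumes "N \<ge> 2"
  shows "equiv {0..1} (thompson_orbit_rel N) \<and>
         standard_rel unit_lebesgue (thompson_orbit_rel N) \<and>
         quasi_preserving_rel unit_lebesgue (thompson_orbit_rel N) \<and>
         ergodic_rel unit_lebesgue (thompson_orbit_rel N)"
proof (intro conjI)
  show "equiv {0..1} (thompson_orbit_rel N)"
    using assms by (intro equiv_thompson_orbit_rel) simp
  show "standard_rel unit_lebesgue (thompson_orbit_rel N)"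
    using assms by (intro standard_thompson_orbit_rel) simp
  show "quasi_preserving_rel unit_lebesgue (thompson_orbit_rel N)"
    using assms by (intro quasi_preserving_thompson_orbit_rel) simp
  show "ergodic_rel unit_lebesgue (thompson_orbit_rel N)"
    using assms by (rule ergodic_thompson_orbit_rel)
qed

end
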